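(* Let $\mathcal{H}$ and $\mathcal{K}$ be Hilbert spaces and let $A\in\mathcal{L}(\mathcal{H},\mathcal{K})$ and closed subspaces $\mathcal{T}\subseteq\mathcal{H}$, $\mathcal{S}\subseteq\mathcal{K}$ be such that $A^{(2)}_{\mathcal{T},\mathcal{S}}$ exists. Let $(A_n)_{n\in\mathbb{N}}\subset\mathcal{L}(\mathcal{H},\mathcal{K})$ and let $(\mathcal{T}_n)_{n\in\mathbb{N}}$ and $(\mathcal{S}_n)_{n\in\mathbb{N}}$ be sequences of closed subspaces of $\mathcal{H}$ and $\mathcal{K}$, respectively, such that $(A_n)^{(2)}_{\mathcal{T}_n,\mathcal{S}_n}$ exists for each $n\in\mathbb{N}$. If $(A_n)_{n\in\mathbb{N}}$ converges to $A$, then the following statements are equivalent (limits as $n\to\infty$, in operator norm). (i) $(A_n)^{(2)}_{\mathcal{T}_n,\mathcal{S}_n}\to A^{(2)}_{\mathcal{T},\mathcal{S}}$. (ii) $(A_n)^{(2)}_{\mathcal{T}_n,\mathcal{S}_n}A_n\to A^{(2)}_{\mathcal{T},\mathcal{S}}A$ and $A_n(A_n)^{(2)}_{\mathcal{T}_n,\mathcal{S}_n}\to AA^{(2)}_{\mathcal{T},\mathcal{S}}$. (iii) $(A_n)^{(2)}_{\mathcal{T}_n,\mathcal{S}_n}A_n\to A^{(2)}_{\mathcal{T},\mathcal{S}}A$ and $P^\perp_{\mathcal{S}_n^\perp}\to P^\perp_{\mathcal{S}^\perp}$. (iv) $A_n(A_n)^{(2)}_{\mathcal{T}_n,\mathcal{S}_n}\to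 AA^{(2)}_{\mathcal{T},\mathcal{S}}$ and $P^\perp_{\mathcal{T}_n}\to P^\perp_{\mathcal{T}}$. (v) $P^\perp_{\mathcal{S}_n^\perp}\to P^\perp_{\mathcal{S}^\perp}$ and $P^\perp_{\mathcal{T}_n}\to P^\perp_{\mathcal{T}}$.
   Context: For a closed subspace $\mathcal{M}$ of a Hilbert space, $P^\perp_{\mathcal{M}}$ denotes the orthogonal projection with range $\mathcal{M}$ (so $P^\perp_{\mathcal{S}^\perp}$ is the orthogonal projection onto the orthogonal complement $\mathcal{S}^\perp$). For $A\in\mathcal{L}(\mathcal{H},\mathcal{K})$ (bounded linear operators) and closed subspaces $\mathcal{T}\subseteq\mathcal{H}$, $\mathcal{S}\subseteq\mathcal{K}$, the outer inverse $A^{(2)}_{\mathcal{T},\mathcal{S}}$ is the (necessarily unique, if it exists) operator $B\in\mathcal{L}(\mathcal{K},\mathcal{H})$ with $BAB=B$, range $\mathcal{R}(B)=\mathcal{T}$ and null space $\mathcal{N}(B)=\mathcal{S}$. *)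

theory Defs
  imports "HOL-Analysis.Analysis"
begin

text \<open>Hilbert spaces are real or complex. A normed field with multiplicative norm over the
  reals is isomorphic to the reals or to the complex numbers, so the following class consists
  exactly of these two scalar fields; the axioms force \<open>rc_cnj\<close> to be the conjugation.\<close>

class rc_field = real_normed_field +
  fixes rc_cnj :: "'a \<Rightarrow> 'a"
  assumes rc_cnj_add: "rc_cnj (x + y) = rc_cnj x + rc_cnj y"
    and mult_rc_cnj: "x * rc_cnj x = (norm x)\<^sup>2 *\<^sub>R 1"

instantiation real :: rc_field
begin
definition rc_cnj_real :: "real \<Rightarrow> real" where "rc_cnj_real x = x"
instance by standard (simp_all add: rc_cnj_real_def power2_eq_square)
end

instantiation complex :: rc_field
begin
definition rc_cnj_complex :: "complex \<Rightarrow> complex" where "rc_cnj_complex = cnj"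
instance
proof
  show "rc_cnj (x + y) = rc_cnj x + rc_cnj y" for x y :: complex
    by (simp add: rc_cnj_complex_def)
  show "x * rc_cnj x = (norm x)\<^sup>2 *\<^sub>R 1" for x :: complex
    unfolding rc_cnj_complex_def of_real_def[symmetric] by (rule complex_norm_square[symmetric])
qed
end

text \<open>The norm and the completeness of the class \<^class>\<open>banach\<close> are those of the inner
  product, because of \<open>ip_self\<close>. The inner product is linear in its first argument.\<close>

locale hilbert_space = vector_space scale
  for scale :: "'f::rc_field \<Rightarrow> 'a::banach \<Rightarrow> 'a" +
  fixes ip :: "'a \<Rightarrow> 'a \<Rightarrow> 'f"
  assumes scale_of_real: "scale (of_real r) x = r *\<^sub>R x"
    and ip_add_left: "ip (x + y) z = ip x z + ip y z"
    and ip_scale_left: "ip (scale c x) y = c * ip x y"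
    and ip_commute: "ip y x = rc_cnj (ip x y)"
    and ip_self: "ip x x = of_real ((norm x)\<^sup>2)"

lemma hilbert_space_real:
  "hilbert_space (*\<^sub>R) (inner :: 'a::{real_inner, banach} \<Rightarrow> 'a \<Rightarrow> real)"
  by unfold_locales
    (simp_all add: scaleR_add_left scaleR_add_right inner_add_left rc_cnj_real_def
      power2_norm_eq_inner, rule inner_commute)

lemma hilbert_space_complex: "hilbert_space (*) (\<lambda>x y :: complex. x * cnj y)"
proof unfold_locales
  show "x * cnj x = of_real ((norm x)\<^sup>2)" for x
    by (rule complex_norm_square[symmetric])
qed (simp_all add: distrib_left distrib_right rc_cnj_complex_def scaleR_conv_of_real)

text \<open>The type of bounded real-linear maps carries the operator norm, also for complex scalars;
  an operator is then a member that is linear over the scalar field.\<close>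

definition bounded_ops ::
  "('f::rc_field \<Rightarrow> 'a::banach \<Rightarrow> 'a) \<Rightarrow> ('f \<Rightarrow> 'b::banach \<Rightarrow> 'b) \<Rightarrow> ('a \<Rightarrow>\<^sub>L 'b) set" where
  "bounded_ops sa sb = {A. Vector_Spaces.linear sa sb (blinfun_apply A)}"

definition closed_subspace :: "('f::rc_field \<Rightarrow> 'a::banach \<Rightarrow> 'a) \<Rightarrow> 'a set \<Rightarrow> bool" where
  "closed_subspace s M \<longleftrightarrow> module.subspace s M \<and> closed M"

definition null_space :: "('a::banach \<Rightarrow>\<^sub>L 'b::banach) \<Rightarrow> 'a set" where
  "null_space A = {x. blinfun_apply A x = 0}"

definition orth_compl :: "('a \<Rightarrow> 'a \<Rightarrow> 'f::rc_field) \<Rightarrow> 'a set \<Rightarrow> 'a set" where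
  "orth_compl ip M = {x. \<forall>y\<in>M. ip x y = 0}"

definition is_orth_proj ::
  "('f::rc_field \<Rightarrow> 'a::banach \<Rightarrow> 'a) \<Rightarrow> ('a \<Rightarrow> 'a \<Rightarrow> 'f) \<Rightarrow> 'a set \<Rightarrow> ('a \<Rightarrow>\<^sub>L 'a) \<Rightarrow> bool" where
  "is_orth_proj s ip M P \<longleftrightarrow>
     P \<in> bounded_ops s s \<and> P o\<^sub>L P = P \<and>
     range (blinfun_apply P) = M \<and> null_space P = orth_compl ip M"

definition orth_proj ::
  "('f::rc_field \<Rightarrow> 'a::banach \<Rightarrow> 'a) \<Rightarrow> ('a \<Rightarrow> 'a \<Rightarrow> 'f) \<Rightarrow> 'a set \<Rightarrow> ('a \<Rightarrow>\<^sub>L 'a)" where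
  "orth_proj s ip M = (THE P. is_orth_proj s ip M P)"

definition is_outer_inverse ::
  "('f::rc_field \<Rightarrow> 'a::banach \<Rightarrow> 'a) \<Rightarrow> ('f \<Rightarrow> 'b::banach \<Rightarrow> 'b) \<Rightarrow>
     ('a \<Rightarrow>\<^sub>L 'b) \<Rightarrow> 'a set \<Rightarrow> 'b set \<Rightarrow> ('b \<Rightarrow>\<^sub>L 'a) \<Rightarrow> bool" where
  "is_outer_inverse sa sb A T S B \<longleftrightarrow>
     B \<in> bounded_ops sb sa \<and> B o\<^sub>L A o\<^sub>L B = B \<and>
     range (blinfun_apply B) = T \<and> null_space B = S"

definition outer_inverse ::
  "('f::rc_field \<Rightarrow> 'a::banach \<Rightarrow> 'a) \<Rightarrow> ('f \<Rightarrow> 'b::banach \<Rightarrow> 'b) \<Rightarrow>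
     ('a \<Rightarrow>\<^sub>L 'b) \<Rightarrow> 'a set \<Rightarrow> 'b set \<Rightarrow> ('b \<Rightarrow>\<^sub>L 'a)" where
  "outer_inverse sa sb A T S = (THE B. is_outer_inverse sa sb A T S B)"

lemma blinfun_eq_of_range_null_space:
  assumes B: "B o\<^sub>L A o\<^sub>L B = B" and C: "C o\<^sub>L A o\<^sub>L C = C"
    and range: "range (blinfun_apply B) = range (blinfun_apply C)"
    and null: "null_space B = null_space C"
  shows "B = C"
proof (rule blinfun_eqI)
  fix y
  have BAB: "B (A (B x)) = B x" for x
    using arg_cong[OF B, of "\<lambda>F. F x"] by simp
  have CAC: "C (A (C x)) = C x" for x
    using arg_cong[OF C, of "\<lambda>F. F x"] by simp
  have "y - A (B y) \<in> null_space B"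
    by (simp add: null_space_def blinfun.diff_right BAB)
  then have "y - A (B y) \<in> null_space C"
    by (simp only: null)
  then have Cy: "C y = C (A (B y))"
    by (simp add: null_space_def blinfun.diff_right)
  obtain z where z: "B y = C z"
    using range by blast
  show "B y = C y"
    unfolding Cy unfolding z by (rule CAC[symmetric])
qed

lemma is_outer_inverse_unique:
  assumes "is_outer_inverse sa sb A T S B" and "is_outer_inverse sa sb A T S C"
  shows "B = C"
  using assms unfolding is_outer_inverse_def
  by (intro blinfun_eq_of_range_null_space[of B A C]) simp_all

lemma is_orth_proj_unique:
  fixes P Q :: "'a::banach \<Rightarrow>\<^sub>L 'a"
  assumes "is_orth_proj s ip M P" and "is_orth_proj s ip M Q"
  shows "P = Q"
proof -
  have "R o\<^sub>L id_blinfun o\<^sub>L R = R o\<^sub>L R" for R :: "'a \<Rightarrow>\<^sub>L 'a"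
    by (rule blinfun_eqI) simp
  with assms show ?thesis
    unfolding is_orth_proj_def
    by (intro blinfun_eq_of_range_null_space[of P id_blinfun Q]) simp_all
qed

end

theory Submission
  imports Defs
begin

text \<open>If \<open>E\<close> and \<open>F\<close> are idempotents with ranges \<open>M\<close> and \<open>N\<close>, then the orthogonal projections onto
  \<open>M\<close> and \<open>N\<close> differ by at most \<open>2 * norm (E - F)\<close>. Applied to \<open>B\<^sub>n A\<^sub>n\<close> (range \<open>T\<^sub>n\<close>) and \<open>1 - A\<^sub>n B\<^sub>n\<close>
  (range \<open>S\<^sub>n\<close>), this shows that each of the conditions (i)--(iv) implies (v). Conversely, with \<open>P\<^sub>n\<close>, \<open>Q\<^sub>n\<close> the
  orthogonal projections onto \<open>T\<^sub>n\<close> and onto the orthogonal complement of \<open>S\<^sub>n\<close>,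
  \<open>B\<^sub>n - B = B\<^sub>n (Q\<^sub>n - Q) (1 - A B) + (1 - B\<^sub>n A\<^sub>n) (P\<^sub>n - P) B - B\<^sub>n (A\<^sub>n - A) B\<close>,
  so \<open>norm (B\<^sub>n - B) \<le> norm B\<^sub>n * \<epsilon>\<^sub>n + \<delta>\<^sub>n\<close> with null sequences \<open>\<epsilon>\<close> and \<open>\<delta>\<close>, and this forces
  \<open>B\<^sub>n\<close> to converge to \<open>B\<close>.\<close>

section \<open>Geometry of Hilbert spaces\<close>

lemma rc_cnj_0 [simp]: "rc_cnj 0 = (0 :: 'f::rc_field)"
  using rc_cnj_add[of "0 :: 'f" 0] by simp

lemma mult_rc_cnj_of_real: "x * rc_cnj x = of_real ((norm x)\<^sup>2)" for x :: "'f::rc_field"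
  using mult_rc_cnj[of x] by (simp add: of_real_def)

text \<open>The class axioms provide only additivity and \<open>x * rc_cnj x = |x|^2\<close>. Since
  the norm is multiplicative, \<open>x * y\<close> times either side equals
  \<open>|x * y|^2\<close>, and a nonzero \<open>x * y\<close> cancels.\<close>

lemma rc_cnj_mult: "rc_cnj (x * y) = rc_cnj x * rc_cnj y" for x y :: "'f::rc_field"
proof (cases "x * y = 0")
  case True
  then show ?thesis by auto
next
  case False
  have "(x * y) * rc_cnj (x * y) = (x * rc_cnj x) * (y * rc_cnj y)"
    unfolding mult_rc_cnj_of_real by (simp add: norm_mult power_mult_distrib)
  also have "\<dots> = (x * y) * (rc_cnj x * rc_cnj y)"
    by (simp add: mult_ac)
  finally show ?thesis
    using False by (metis mult_left_cancel)
qed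

context hilbert_space
begin

lemma ip_add_right: "ip x (y + z) = ip x y + ip x z"
  by (subst (1 2 3) ip_commute) (simp add: ip_add_left rc_cnj_add)

lemma ip_0_left [simp]: "ip 0 y = 0"
  using ip_add_left[of 0 0 y] by simp

lemma ip_0_right [simp]: "ip x 0 = 0"
  using ip_add_right[of x 0 0] by simp

lemma ip_diff_left: "ip (x - y) z = ip x z - ip y z"
  using ip_add_left[of "x - y" y z] by simp

lemma ip_diff_right: "ip x (y - z) = ip x y - ip x z"
  using ip_add_right[of x "y - z" z] by simp

lemma ip_scale_right: "ip x (scale c y) = rc_cnj c * ip x y"
  by (subst (1 2) ip_commute) (simp add: ip_scale_left rc_cnj_mult)

lemma ip_eq_0_sym: "ip x y = 0 \<Longrightarrow> ip y x = 0"
  by (subst ip_commute) simp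

lemma ip_self_eq_0_iff: "ip x x = 0 \<longleftrightarrow> x = 0"
  unfolding ip_self by simp

text \<open>The locale ties \<open>scale\<close> to the norm directly only for real scalars; for
  general scalars the link goes through \<open>ip_self\<close>.\<close>

lemma norm_scale: "norm (scale c x) = norm c * norm x"
proof -
  have "of_real ((norm (scale c x))\<^sup>2) = (c * rc_cnj c) * ip x x"
    by (simp only: ip_self[symmetric] ip_scale_left ip_scale_right mult_ac)
  also have "\<dots> = of_real ((norm c * norm x)\<^sup>2)"
    by (simp add: mult_rc_cnj_of_real ip_self power_mult_distrib)
  finally have "(norm (scale c x))\<^sup>2 = (norm c * norm x)\<^sup>2"
    by (simp only: of_real_eq_iff)
  then show ?thesis
    by (simp add: power2_eq_iff_nonneg)
qed

lemma pythagoras: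
  assumes "ip x y = 0"
  shows "(norm (x + y))\<^sup>2 = (norm x)\<^sup>2 + (norm y)\<^sup>2"
proof -
  have "of_real ((norm (x + y))\<^sup>2) = (of_real ((norm x)\<^sup>2 + (norm y)\<^sup>2) :: 'f)"
    using assms ip_eq_0_sym[OF assms]
    by (simp only: ip_self[symmetric] of_real_add ip_add_left ip_add_right) simp
  then show ?thesis
    by (simp only: of_real_eq_iff)
qed

lemma parallelogram:
  fixes x y :: 'a
  shows "(norm (x + y))\<^sup>2 + (norm (x - y))\<^sup>2 = 2 * (norm x)\<^sup>2 + 2 * (norm y)\<^sup>2"
proof -
  have "of_real ((norm (x + y))\<^sup>2 + (norm (x - y))\<^sup>2) = ip (x + y) (x + y) + ip (x - y) (x - y)"
    by (simp only: ip_self of_real_add)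
  also have "\<dots> = 2 * ip x x + 2 * ip y y"
    by (simp add: ip_add_left ip_add_right ip_diff_left ip_diff_right)
  also have "\<dots> = of_real (2 * (norm x)\<^sup>2 + 2 * (norm y)\<^sup>2)"
    by (simp add: ip_self)
  finally show ?thesis
    by (simp only: of_real_eq_iff)
qed

text \<open>\<open>scale c y\<close> is the component of \<open>x\<close> along \<open>y\<close>, so
  Pythagoras applies. Dropping the residual term yields Cauchy-Schwarz; applied to
  \<open>x - m\<close>, the same formula measures how far a shift along \<open>y\<close> reduces the
  distance.\<close>

lemma norm_sub_component:
  fixes x y :: 'a
  assumes "y \<noteq> 0"
  defines "c \<equiv> ip x y / of_real ((norm y)\<^sup>2)"
  shows "(norm x)\<^sup>2 = (norm (x - scale c y))\<^sup>2 + (norm c * norm y)\<^sup>2"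
proof -
  have "ip (x - scale c y) y = 0"
    using assms(1) by (simp add: ip_diff_left ip_scale_left ip_self c_def)
  then have "ip (x - scale c y) (scale c y) = 0"
    by (simp add: ip_scale_right)
  from pythagoras[OF this] show ?thesis
    by (simp add: norm_scale)
qed

lemma cauchy_schwarz: "norm (ip x y) \<le> norm x * norm y"
proof (cases "y = 0")
  case False
  define c where "c = ip x y / of_real ((norm y)\<^sup>2)"
  have "(norm c * norm y)\<^sup>2 \<le> (norm x)\<^sup>2"
    using norm_sub_component[OF False, of x] by (simp add: c_def)
  then have "norm c * norm y \<le> norm x"
    by (simp add: power2_le_iff_abs_le)
  moreover have "norm (ip x y) = norm c * norm y * norm y"
    using False by (simp add: c_def norm_divide norm_mult power2_eq_square)
  ultimately show ?thesis
    by (simp add: mult_right_mono)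
qed simp

text \<open>Moving \<open>m\<close> by the component of \<open>x - m\<close> along \<open>y\<close>
  stays in \<open>M\<close> and lowers the squared distance by exactly
  \<open>(norm c * norm y)^2\<close>; minimality forces this gain to vanish.\<close>

lemma closest_point_orthogonal:
  assumes M: "subspace M" and m: "m \<in> M" and min: "\<And>u. u \<in> M \<Longrightarrow> norm (x - m) \<le> norm (x - u)"
  shows "x - m \<in> orth_compl ip M"
  unfolding orth_compl_def
proof (intro CollectI ballI)
  fix y assume y: "y \<in> M"
  show "ip (x - m) y = 0"
  proof (cases "y = 0")
    case False
    define c where "c = ip (x - m) y / of_real ((norm y)\<^sup>2)"
    have "norm (x - m) \<le> norm (x - m - scale c y)"
      using min[of "m + scale c y"] subspace_add[OF M m subspace_scale[OF M y]]
      by (simp add: diff_diff_eq)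
    then have "(norm (x - m))\<^sup>2 \<le> (norm (x - m - scale c y))\<^sup>2"
      by (intro power_mono) auto
    then have "(norm c * norm y)\<^sup>2 \<le> 0"
      using norm_sub_component[OF False, of "x - m"] by (simp add: c_def)
    with False show ?thesis
      by (simp add: c_def)
  qed simp
qed

text \<open>The classical argument: a minimizing sequence for the distance to \<open>M\<close> is
  Cauchy by the parallelogram law, and its limit is a closest point.\<close>

theorem orthogonal_decomposition:
  assumes "closed_subspace scale M"
  shows "\<exists>m\<in>M. x - m \<in> orth_compl ip M"
proof -
  have M: "subspace M" and "closed M"
    using assms by (auto simp: closed_subspace_def)
  define d where "d = (INF m\<in>M. (norm (x - m))\<^sup>2)"
  have bdd: "bdd_below ((\<lambda>m. (norm (x - m))\<^sup>2) ` M)"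
    by (intro bdd_belowI[of _ 0]) auto
  have ne: "M \<noteq> {}"
    using subspace_0[OF M] by auto
  have d_le: "d \<le> (norm (x - u))\<^sup>2" if "u \<in> M" for u
    unfolding d_def using that by (intro cINF_lower bdd)
  have "\<exists>m\<in>M. (norm (x - m))\<^sup>2 < d + inverse (real (Suc k))" for k
    using cINF_less_iff[OF ne bdd, of "d + inverse (real (Suc k))"]
    by (simp add: d_def)
  then obtain m where m: "\<And>k. m k \<in> M"
    and m_lt: "\<And>k. (norm (x - m k))\<^sup>2 < d + inverse (real (Suc k))"
    by metis
  have dist: "(norm (m j - m k))\<^sup>2 \<le> 2 * inverse (real (Suc j)) + 2 * inverse (real (Suc k))" for j k
  proof -
    \<comment> \<open>The midpoint lies in \<open>M\<close>, so its squared distance to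
      \<open>x\<close> is at least \<open>d\<close>. In the parallelogram law this cancels the
      \<open>2 * d + 2 * d\<close> coming from the two near-minimal distances and leaves only the
      errors.\<close>
    have "(1/2) *\<^sub>R (m j + m k) \<in> M"
      using subspace_scale[OF M subspace_add[OF M m m], of "of_real (1/2)"] unfolding scale_of_real .
    then have "d \<le> (norm (x - (1/2) *\<^sub>R (m j + m k)))\<^sup>2"
      by (rule d_le)
    also have "x - (1/2) *\<^sub>R (m j + m k) = (1/2) *\<^sub>R ((x - m j) + (x - m k))"
      by (simp add: algebra_simps flip: scaleR_add_left)
    finally have "4 * d \<le> (norm ((x - m j) + (x - m k)))\<^sup>2"
      by (simp add: power_divide)
    moreover have "norm ((x - m j) - (x - m k)) = norm (m j - m k)"
      by (simp add: norm_minus_commute)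
    ultimately show ?thesis
      using parallelogram[of "x - m j" "x - m k"] m_lt[of j] m_lt[of k] by simp
  qed
  have "Cauchy m"
  proof (rule metric_CauchyI)
    fix e :: real assume "e > 0"
    \<comment> \<open>With \<open>e\<^sup>2 / 4\<close>, each of the two terms of
      \<open>dist\<close> is below half of \<open>e\<^sup>2\<close>.\<close>
    then obtain N where N: "inverse (real (Suc N)) < e\<^sup>2 / 4"
      using reals_Archimedean[of "e\<^sup>2 / 4"] by auto
    have "dist (m j) (m k) < e" if "j \<ge> N" "k \<ge> N" for j k
    proof -
      have "inverse (real (Suc i)) \<le> inverse (real (Suc N))" if "i \<ge> N" for i
        using that by (intro le_imp_inverse_le) auto
      from this[OF that(1)] this[OF that(2)] have "(norm (m j - m k))\<^sup>2 < e\<^sup>2"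
        using dist[of j k] N by linarith
      with \<open>e > 0\<close> show ?thesis
        by (simp add: dist_norm power_less_imp_less_base)
    qed
    then show "\<exists>N. \<forall>j\<ge>N. \<forall>k\<ge>N. dist (m j) (m k) < e"
      by blast
  qed
  then obtain l where l: "m \<longlonglongrightarrow> l"
    using Cauchy_convergent convergent_def by blast
  have "l \<in> M"
    using closed_sequentially[OF \<open>closed M\<close>] m l by blast
  have "(\<lambda>k. (norm (x - m k))\<^sup>2) \<longlonglongrightarrow> (norm (x - l))\<^sup>2"
    by (intro tendsto_intros l)
  moreover have "(\<lambda>k. d + inverse (real (Suc k))) \<longlonglongrightarrow> d + 0"
    by (intro tendsto_intros LIMSEQ_inverse_real_of_nat)
  ultimately have "(norm (x - l))\<^sup>2 \<le> d + 0"
    by (rule LIMSEQ_le) (intro exI[of _ 0] allI impI less_imp_le[OF m_lt])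
  then have "(norm (x - l))\<^sup>2 \<le> (norm (x - u))\<^sup>2" if "u \<in> M" for u
    using d_le[OF that] by linarith
  then have "norm (x - l) \<le> norm (x - u)" if "u \<in> M" for u
    using that power2_le_imp_le norm_ge_zero by blast
  then show ?thesis
    using closest_point_orthogonal[OF M \<open>l \<in> M\<close>] \<open>l \<in> M\<close> by blast
qed

section \<open>Orthogonal projections\<close>

lemma subspace_orth_compl: "subspace (orth_compl ip M)"
  by (rule subspaceI) (auto simp: orth_compl_def ip_add_left ip_scale_left)

lemma is_orth_proj_exists:
  assumes M: "closed_subspace scale M"
  shows "\<exists>P. is_orth_proj scale ip M P"
proof -
  let ?C = "orth_compl ip M"
  have sub: "subspace M"
    using M by (simp add: closed_subspace_def)
  obtain p where p: "\<And>x. p x \<in> M" and q: "\<And>x. x - p x \<in> ?C"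
    using orthogonal_decomposition[OF M] by metis
  \<comment> \<open>Uniqueness of the decomposition: two candidates differ by a vector in
    \<open>M\<close> that is orthogonal to itself. Linearity, the fixed points and the kernel of
    \<open>p\<close> all follow by exhibiting a decomposition.\<close>
  have p_eqI: "p x = u" if "u \<in> M" "x - u \<in> ?C" for x u
  proof -
    have "p x - u \<in> M"
      by (intro subspace_diff sub p that)
    moreover have "(x - u) - (x - p x) \<in> ?C"
      by (intro subspace_diff subspace_orth_compl q that)
    ultimately have "ip (p x - u) (p x - u) = 0"
      by (simp add: orth_compl_def)
    then show ?thesis
      by (simp add: ip_self_eq_0_iff)
  qed
  have add: "p (x + y) = p x + p y" for x y
    using subspace_add[OF subspace_orth_compl q q, of x y]
    by (intro p_eqI subspace_add sub p) (simp add: algebra_simps)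
  have scl: "p (scale c x) = scale c (p x)" for c x
    using subspace_scale[OF subspace_orth_compl q, of c x]
    by (intro p_eqI subspace_scale sub p) (simp add: scale_right_diff_distrib)
  have "bounded_linear p"
  proof (rule bounded_linear_intro[where K = 1])
    show "p (r *\<^sub>R x) = r *\<^sub>R p x" for r x
      using scl[of "of_real r" x] by (simp only: scale_of_real)
    show "norm (p x) \<le> norm x * 1" for x
    proof -
      have "ip (x - p x) (p x) = 0"
        using p q by (auto simp: orth_compl_def)
      then have "(norm x)\<^sup>2 = (norm (x - p x))\<^sup>2 + (norm (p x))\<^sup>2"
        using pythagoras[of "x - p x" "p x"] by simp
      then have "(norm (p x))\<^sup>2 \<le> (norm x)\<^sup>2"
        by simp
      then have "norm (p x) \<le> norm x"
        by (rule power2_le_imp_le) simp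
      then show ?thesis
        by simp
    qed
  qed (rule add)
  then have apply_p: "blinfun_apply (Blinfun p) = p"
    by (rule bounded_linear_Blinfun_apply)
  have fix_p: "p u = u" if "u \<in> M" for u
    using that subspace_0[OF subspace_orth_compl] by (intro p_eqI) auto
  have "is_orth_proj scale ip M (Blinfun p)"
    unfolding is_orth_proj_def bounded_ops_def null_space_def apply_p
  proof (intro conjI CollectI)
    show "Vector_Spaces.linear scale scale (blinfun_apply (Blinfun p))"
      unfolding apply_p by unfold_locales (simp_all add: add scl)
    show "Blinfun p o\<^sub>L Blinfun p = Blinfun p"
      by (rule blinfun_eqI) (simp add: apply_p fix_p p)
    show "range p = M"
      using p fix_p by (metis image_subset_iff rangeI subsetI subset_antisym)
    show "{x. p x = 0} = ?C"
    proof (intro equalityI subsetI CollectI)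
      show "x \<in> ?C" if "x \<in> {x. p x = 0}" for x
        using q[of x] that by simp
      show "p x = 0" if "x \<in> ?C" for x
        using that by (intro p_eqI) (auto simp: subspace_0[OF sub])
    qed
  qed
  then show ?thesis ..
qed

lemma is_orth_proj_orth_proj:
  assumes "closed_subspace scale M"
  shows "is_orth_proj scale ip M (orth_proj scale ip M)"
  unfolding orth_proj_def
  by (rule theI') (use is_orth_proj_exists[OF assms] is_orth_proj_unique in blast)

lemma orth_proj_eqI: "is_orth_proj scale ip M P \<Longrightarrow> orth_proj scale ip M = P"
  unfolding orth_proj_def by (rule the_equality) (auto intro: is_orth_proj_unique)

context
  fixes M P
  assumes P: "is_orth_proj scale ip M P"
begin

lemma orth_proj_in: "blinfun_apply P x \<in> M"
  using P by (auto simp: is_orth_proj_def)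

lemma orth_proj_idem: "blinfun_apply P (blinfun_apply P x) = blinfun_apply P x"
  using P by (metis is_orth_proj_def blinfun_apply_blinfun_compose)

lemma orth_proj_fix: "u \<in> M \<Longrightarrow> blinfun_apply P u = u"
  using P orth_proj_idem by (auto simp: is_orth_proj_def)

lemma orth_proj_eq_0_iff: "blinfun_apply P x = 0 \<longleftrightarrow> x \<in> orth_compl ip M"
  using P by (auto simp: is_orth_proj_def null_space_def)

lemma orth_proj_residual: "x - blinfun_apply P x \<in> orth_compl ip M"
  by (simp add: orth_proj_idem blinfun.diff_right flip: orth_proj_eq_0_iff)

lemma norm_orth_proj_decomp:
  "(norm x)\<^sup>2 = (norm (x - blinfun_apply P x))\<^sup>2 + (norm (blinfun_apply P x))\<^sup>2"
  using pythagoras[of "x - blinfun_apply P x" "blinfun_apply P x"] orth_proj_residual orth_proj_in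
  by (simp add: orth_compl_def)

lemma norm_orth_proj_le: "norm (blinfun_apply P x) \<le> norm x"
  by (rule power2_le_imp_le) (auto simp: norm_orth_proj_decomp[of x])

lemma norm_orth_proj_residual_le: "norm (x - blinfun_apply P x) \<le> norm x"
  by (rule power2_le_imp_le) (auto simp: norm_orth_proj_decomp[of x])

text \<open>This mediates between the projections onto orthogonal complements in the theorem and
  idempotents whose range is the subspace itself. The null space condition amounts to
  \<open>M\<close> being its own double complement.\<close>

lemma is_orth_proj_orth_compl: "is_orth_proj scale ip (orth_compl ip M) (id_blinfun - P)"
  unfolding is_orth_proj_def bounded_ops_def
proof (intro conjI CollectI)
  have "Vector_Spaces.linear scale scale (blinfun_apply P)"
    using P by (simp add: is_orth_proj_def bounded_ops_def)
  then interpret P: Vector_Spaces.linear scale scale "blinfun_apply P" .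
  show "Vector_Spaces.linear scale scale (blinfun_apply (id_blinfun - P))"
    by unfold_locales
      (simp_all add: blinfun.diff_left blinfun.add_right P.scale scale_right_diff_distrib)
  show "(id_blinfun - P) o\<^sub>L (id_blinfun - P) = id_blinfun - P"
    by (rule blinfun_eqI) (simp add: blinfun.diff_left blinfun.diff_right orth_proj_idem)
  show "range (blinfun_apply (id_blinfun - P)) = orth_compl ip M"
  proof (intro equalityI subsetI)
    show "x \<in> orth_compl ip M" if "x \<in> range (blinfun_apply (id_blinfun - P))" for x
      using that orth_proj_residual by (auto simp: blinfun.diff_left)
    show "x \<in> range (blinfun_apply (id_blinfun - P))" if "x \<in> orth_compl ip M" for x
      using that by (intro range_eqI[of _ _ x]) (simp add: blinfun.diff_left flip: orth_proj_eq_0_iff)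
  qed
  show "null_space (id_blinfun - P) = orth_compl ip (orth_compl ip M)"
  proof (intro equalityI subsetI)
    fix x assume "x \<in> null_space (id_blinfun - P)"
    then have "x = P x"
      by (simp add: null_space_def blinfun.diff_left)
    then have "x \<in> M"
      using orth_proj_in by metis
    then show "x \<in> orth_compl ip (orth_compl ip M)"
      by (auto simp: orth_compl_def intro: ip_eq_0_sym)
  next
    \<comment> \<open>Both \<open>x\<close> and \<open>P x\<close> are orthogonal to
      \<open>x - P x\<close>, so this residual is orthogonal to itself and vanishes.\<close>
    fix x assume "x \<in> orth_compl ip (orth_compl ip M)"
    then have "ip x (x - P x) = 0"
      using orth_proj_residual by (auto simp: orth_compl_def)
    moreover have "ip (P x) (x - P x) = 0"
      using orth_proj_residual[of x] orth_proj_in[of x]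
      by (auto simp: orth_compl_def intro: ip_eq_0_sym)
    ultimately have "ip (x - P x) (x - P x) = 0"
      by (simp add: ip_diff_left)
    then show "x \<in> null_space (id_blinfun - P)"
      by (simp add: ip_self_eq_0_iff null_space_def blinfun.diff_left)
  qed
qed

end

text \<open>\<open>1 - Q\<close> kills the range of \<open>F\<close>, so
  \<open>u - Q u = (1 - Q) (E - F) u\<close>, and \<open>1 - Q\<close> is a contraction.\<close>

lemma norm_orth_proj_residual_le_idempotents:
  assumes Q: "is_orth_proj scale ip N Q"
    and E: "E o\<^sub>L E = E" "range (blinfun_apply E) = M" and F: "range (blinfun_apply F) = N"
    and u: "u \<in> M"
  shows "norm (u - blinfun_apply Q u) \<le> norm (E - F) * norm u"
proof -
  have "E u = u"
    using E u by (metis blinfun_apply_blinfun_compose imageE)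
  then have "u - Q u = (E - F) u - Q ((E - F) u)"
    using orth_proj_fix[OF Q, of "F u"] F by (auto simp: blinfun.diff_left blinfun.diff_right)
  then have "norm (u - Q u) \<le> norm ((E - F) u)"
    using norm_orth_proj_residual_le[OF Q] by simp
  also have "\<dots> \<le> norm (E - F) * norm u"
    by (rule norm_blinfun)
  finally show ?thesis .
qed

text \<open>Split \<open>Q - P = Q (1 - P) - (1 - Q) P\<close>. The second term is a residual of a
  vector of \<open>M\<close>; the first is reduced by duality to a residual of a vector of
  \<open>N\<close>. Each contributes one \<open>norm (E - F)\<close>, hence the factor 2.\<close>

lemma norm_orth_proj_diff_le:
  assumes P: "is_orth_proj scale ip M P" and Q: "is_orth_proj scale ip N Q"
    and E: "E o\<^sub>L E = E" "range (blinfun_apply E) = M"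
    and F: "F o\<^sub>L F = F" "range (blinfun_apply F) = N"
  shows "norm (Q - P) \<le> 2 * norm (E - F)"
proof (rule norm_blinfun_bound)
  fix x
  define y where "y = x - P x"
  have y: "y \<in> orth_compl ip M" and norm_y: "norm y \<le> norm x"
    using orth_proj_residual[OF P] norm_orth_proj_residual_le[OF P] by (simp_all add: y_def)
  have "norm (Q y) \<le> norm (E - F) * norm y"
  proof (cases "Q y = 0")
    case False
    have "ip (Q y) (y - Q y) = 0"
      using orth_proj_residual[OF Q, of y] orth_proj_in[OF Q, of y]
      by (auto simp: orth_compl_def intro: ip_eq_0_sym)
    moreover have "ip (P (Q y)) y = 0"
      using y orth_proj_in[OF P] by (auto simp: orth_compl_def intro: ip_eq_0_sym)
    \<comment> \<open>Orthogonality gives \<open>ip (Q y) y = ip (Q y) (Q y)\<close>, and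
      subtracting \<open>P (Q y)\<close> is free because \<open>y\<close> is orthogonal to
      \<open>M\<close>. The residual bound, with the two subspaces exchanged, then leaves one factor
      \<open>norm (Q y)\<close> to cancel.\<close>
    ultimately have "of_real ((norm (Q y))\<^sup>2) = ip (Q y - P (Q y)) y"
      by (simp add: ip_diff_left ip_diff_right ip_self)
    then have "(norm (Q y))\<^sup>2 = norm (ip (Q y - P (Q y)) y)"
      by (metis norm_of_real abs_of_nonneg zero_le_power2)
    also have "\<dots> \<le> norm (Q y - P (Q y)) * norm y"
      by (rule cauchy_schwarz)
    also have "\<dots> \<le> (norm (E - F) * norm (Q y)) * norm y"
      using norm_orth_proj_residual_le_idempotents[OF P F E(2) orth_proj_in[OF Q, of y]]
      by (intro mult_right_mono) (simp_all add: norm_minus_commute)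
    finally show ?thesis
      using False by (simp add: power2_eq_square mult_ac)
  qed simp
  then have "norm (Q y) \<le> norm (E - F) * norm x"
    using norm_y by (meson mult_left_mono norm_ge_zero order_trans)
  moreover have "norm (P x - Q (P x)) \<le> norm (E - F) * norm x"
    using norm_orth_proj_residual_le_idempotents[OF Q E F(2) orth_proj_in[OF P, of x]]
      norm_orth_proj_le[OF P, of x]
    by (meson mult_left_mono norm_ge_zero order_trans)
  moreover have "(Q - P) x = Q y - (P x - Q (P x))"
    by (simp add: y_def blinfun.diff_left blinfun.diff_right)
  ultimately show "norm ((Q - P) x) \<le> 2 * norm (E - F) * norm x"
    using norm_triangle_ineq4[of "Q y" "P x - Q (P x)"] by simp
qed simp

lemma orth_proj_tendsto:
  assumes M: "closed_subspace scale M" "\<And>n. closed_subspace scale (Mn n)"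
    and E: "E o\<^sub>L E = E" "range (blinfun_apply E) = M"
    and En: "\<And>n. En n o\<^sub>L En n = En n" "\<And>n. range (blinfun_apply (En n)) = Mn n"
    and lim: "En \<longlonglongrightarrow> E"
  shows "(\<lambda>n. orth_proj scale ip (Mn n)) \<longlonglongrightarrow> orth_proj scale ip M"
proof (rule Lim_transform_bound[where g = "\<lambda>n. 2 *\<^sub>R (En n - E)", THEN LIM_zero_cancel])
  show "(\<lambda>n. 2 *\<^sub>R (En n - E)) \<longlonglongrightarrow> 0"
    using tendsto_scaleR[OF tendsto_const LIM_zero[OF lim]] by fastforce
  show "\<forall>\<^sub>F n in sequentially. norm (orth_proj scale ip (Mn n) - orth_proj scale ip M)
      \<le> norm (2 *\<^sub>R (En n - E))"
    using norm_orth_proj_diff_le[OF is_orth_proj_orth_proj[OF M(1)] is_orth_proj_orth_proj[OF M(2)] E En]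
    by (simp add: norm_minus_commute)
qed

lemma orth_proj_orth_compl:
  assumes "closed_subspace scale M"
  shows "orth_proj scale ip (orth_compl ip M) = id_blinfun - orth_proj scale ip M"
  by (intro orth_proj_eqI is_orth_proj_orth_compl is_orth_proj_orth_proj assms)

end

section \<open>Outer inverses\<close>

lemma is_outer_inverse_outer_inverse:
  assumes "\<exists>B. is_outer_inverse sa sb A T S B"
  shows "is_outer_inverse sa sb A T S (outer_inverse sa sb A T S)"
  unfolding outer_inverse_def
  by (rule theI') (use assms is_outer_inverse_unique in blast)

context
  fixes sa sb A T S B
  assumes B: "is_outer_inverse sa sb A T S B"
begin

lemma outer_inverse_apply: "blinfun_apply B (A (B y)) = B y"
  using B by (metis is_outer_inverse_def blinfun_apply_blinfun_compose)

lemma outer_inverse_idem_left: "(B o\<^sub>L A) o\<^sub>L (B o\<^sub>L A) = B o\<^sub>L A"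
  by (rule blinfun_eqI) (simp add: outer_inverse_apply)

text \<open>Every value \<open>B y\<close> equals \<open>B (A (B y))\<close>, so composing with
  \<open>A\<close> loses nothing of the range of \<open>B\<close>.\<close>

lemma outer_inverse_range_left: "range (blinfun_apply (B o\<^sub>L A)) = T"
proof -
  have "range (blinfun_apply (B o\<^sub>L A)) = range (blinfun_apply B)"
    by (auto simp: image_iff) (metis outer_inverse_apply)
  then show ?thesis
    using B by (simp add: is_outer_inverse_def)
qed

lemma outer_inverse_idem_right:
  "(id_blinfun - (A o\<^sub>L B)) o\<^sub>L (id_blinfun - (A o\<^sub>L B)) = id_blinfun - (A o\<^sub>L B)"
  by (rule blinfun_eqI) (simp add: blinfun.diff_left blinfun.diff_right outer_inverse_apply)

text \<open>\<open>B (1 - A B) = 0\<close> puts the range into the null space of \<open>B\<close>,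
  and on that null space \<open>1 - A B\<close> is the identity.\<close>

lemma outer_inverse_range_right: "range (blinfun_apply (id_blinfun - (A o\<^sub>L B))) = S"
proof -
  have "x \<in> range (blinfun_apply (id_blinfun - (A o\<^sub>L B))) \<longleftrightarrow> B x = 0" for x
  proof
    show "B x = 0" if "x \<in> range (blinfun_apply (id_blinfun - (A o\<^sub>L B)))"
      using that by (auto simp: blinfun.diff_left blinfun.diff_right outer_inverse_apply)
    show "x \<in> range (blinfun_apply (id_blinfun - (A o\<^sub>L B)))" if "B x = 0"
      using that by (intro range_eqI[of _ _ x]) (simp add: blinfun.diff_left)
  qed
  then show ?thesis
    using B by (auto simp: is_outer_inverse_def null_space_def)
qed

end

section \<open>Convergence of outer inverses\<close>

lemma tendsto_blinfun_compose:
  "(f \<longlongrightarrow> a) F \<Longrightarrow> (g \<longlongrightarrow> b) F \<Longrightarrow> ((\<lambda>x. f x o\<^sub>L g x) \<longlongrightarrow> a o\<^sub>L b) F"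
  by (rule bounded_bilinear.tendsto[OF bounded_bilinear_blinfun_compose])

text \<open>No bound on \<open>norm (f n)\<close> is known beforehand. It is replaced by
  \<open>norm l + norm (f n - l)\<close>, and as soon as \<open>\<bar>e n\<bar> < 1/2\<close> at
  most half of \<open>norm (f n - l)\<close> reappears on the right and is absorbed. This produces
  the factor 2 in \<open>?g\<close>.\<close>

lemma tendsto_of_norm_diff_le_self:
  fixes f :: "nat \<Rightarrow> 'a::real_normed_vector"
  assumes le: "\<And>n. norm (f n - l) \<le> norm (f n) * e n + d n"
    and e: "e \<longlonglongrightarrow> 0" and d: "d \<longlonglongrightarrow> 0"
  shows "f \<longlonglongrightarrow> l"
proof -
  let ?g = "\<lambda>n. 2 * (norm l * \<bar>e n\<bar> + d n)"
  have "?g \<longlonglongrightarrow> 2 * (norm l * \<bar>0\<bar> + 0)"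
    by (intro tendsto_intros e d)
  then have "?g \<longlonglongrightarrow> 0"
    by simp
  moreover have "\<forall>\<^sub>F n in sequentially. norm (f n - l) \<le> ?g n"
  proof -
    have "\<forall>\<^sub>F n in sequentially. dist (e n) 0 < 1/2"
      using e by (rule tendstoD) simp
    then show ?thesis
    proof eventually_elim
      case (elim n)
      have "norm (f n) \<le> norm l + norm (f n - l)"
        using norm_triangle_sub[of "f n" l] by simp
      then have "norm (f n) * \<bar>e n\<bar> \<le> (norm l + norm (f n - l)) * \<bar>e n\<bar>"
        by (rule mult_right_mono) simp
      also have "\<dots> \<le> norm l * \<bar>e n\<bar> + norm (f n - l) * (1/2)"
        using elim mult_left_mono[of "\<bar>e n\<bar>" "1/2" "norm (f n - l)"] by (simp add: distrib_right)
      finally show ?case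
        using le[of n] mult_left_mono[OF abs_ge_self[of "e n"] norm_ge_zero[of "f n"]] by simp
    qed
  qed
  ultimately show ?thesis
    by (rule Lim_null_comparison[THEN LIM_zero_cancel, rotated])
qed

text \<open>The sum telescopes by \<open>P B = B\<close>, \<open>C A' P' = P'\<close>,
  \<open>Q (1 - A B) = 0\<close> and \<open>C Q' = C\<close>: its terms become
  \<open>C - C A B\<close>, \<open>P' B - B\<close>, \<open>P' B - C A' B\<close> and
  \<open>C A' B - C A B\<close>. \<open>Q\<close> and \<open>Q'\<close> enter through their
  complements, since the ranges \<open>S\<close> and \<open>S'\<close> are what the null spaces of
  \<open>B\<close> and \<open>C\<close> supply.\<close>

lemma outer_inverse_diff:
  assumes H: "hilbert_space sH ipH" and K: "hilbert_space sK ipK"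
    and B: "is_outer_inverse sH sK A T S B" and C: "is_outer_inverse sH sK A' T' S' C"
    and P: "is_orth_proj sH ipH T P" and P': "is_orth_proj sH ipH T' P'"
    and Q: "is_orth_proj sK ipK S (id_blinfun - Q)" and Q': "is_orth_proj sK ipK S' (id_blinfun - Q')"
  shows "C - B = (C o\<^sub>L ((Q' - Q) o\<^sub>L (id_blinfun - (A o\<^sub>L B))))
    + ((P' - P) o\<^sub>L B) - (C o\<^sub>L (A' o\<^sub>L ((P' - P) o\<^sub>L B))) - (C o\<^sub>L ((A' - A) o\<^sub>L B))"
proof (rule blinfun_eqI)
  fix y
  have PB: "P (B y) = B y"
    using B by (intro hilbert_space.orth_proj_fix[OF H P]) (auto simp: is_outer_inverse_def)
  have CA: "C (A' (P' x)) = P' x" for x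
  proof -
    obtain z where "P' x = C z"
      using hilbert_space.orth_proj_in[OF H P', of x] C by (auto simp: is_outer_inverse_def)
    then show ?thesis
      using outer_inverse_apply[OF C] by simp
  qed
  have QB: "Q (y - A (B y)) = 0"
  proof -
    have "y - A (B y) \<in> S"
      using outer_inverse_range_right[OF B] by (force simp: blinfun.diff_left)
    from hilbert_space.orth_proj_fix[OF K Q this] show ?thesis
      by (simp add: blinfun.diff_left)
  qed
  have CQ: "C (Q' x) = C x" for x
  proof -
    have "x - Q' x \<in> S'"
      using hilbert_space.orth_proj_in[OF K Q', of x] by (simp add: blinfun.diff_left)
    then show ?thesis
      using C by (auto simp: is_outer_inverse_def null_space_def blinfun.diff_right)
  qed
  show "(C - B) y = ((C o\<^sub>L ((Q' - Q) o\<^sub>L (id_blinfun - (A o\<^sub>L B))))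
    + ((P' - P) o\<^sub>L B) - (C o\<^sub>L (A' o\<^sub>L ((P' - P) o\<^sub>L B))) - (C o\<^sub>L ((A' - A) o\<^sub>L B))) y"
    using QB by (simp add: blinfun.diff_left blinfun.diff_right blinfun.add_left PB CA CQ)
qed

theorem theorem7p3:
  fixes sH :: "'f::rc_field \<Rightarrow> 'h::banach \<Rightarrow> 'h" and ipH :: "'h \<Rightarrow> 'h \<Rightarrow> 'f"
    and sK :: "'f \<Rightarrow> 'k::banach \<Rightarrow> 'k" and ipK :: "'k \<Rightarrow> 'k \<Rightarrow> 'f"
    and A :: "'h \<Rightarrow>\<^sub>L 'k" and T :: "'h set" and S :: "'k set"
    and An :: "nat \<Rightarrow> 'h \<Rightarrow>\<^sub>L 'k" and Tn :: "nat \<Rightarrow> 'h set" and Sn :: "nat \<Rightarrow> 'k set"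
    and B :: "'k \<Rightarrow>\<^sub>L 'h" and Bn :: "nat \<Rightarrow> 'k \<Rightarrow>\<^sub>L 'h"
  assumes "hilbert_space sH ipH" and "hilbert_space sK ipK"
    and "A \<in> bounded_ops sH sK"
    and "closed_subspace sH T" and "closed_subspace sK S"
    and "\<exists>B. is_outer_inverse sH sK A T S B"
    and "\<And>n. An n \<in> bounded_ops sH sK"
    and "\<And>n. closed_subspace sH (Tn n)" and "\<And>n. closed_subspace sK (Sn n)"
    and "\<And>n. \<exists>B. is_outer_inverse sH sK (An n) (Tn n) (Sn n) B"
    and B: "B = outer_inverse sH sK A T S"
    and Bn: "\<And>n. Bn n = outer_inverse sH sK (An n) (Tn n) (Sn n)"
    and "An \<longlonglongrightarrow> A"
  shows
    "(Bn \<longlonglongrightarrow> B \<longleftrightarrow>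
       (\<lambda>n. Bn n o\<^sub>L An n) \<longlonglongrightarrow> (B o\<^sub>L A) \<and>
       (\<lambda>n. An n o\<^sub>L Bn n) \<longlonglongrightarrow> (A o\<^sub>L B)) \<and>
     (Bn \<longlonglongrightarrow> B \<longleftrightarrow>
       (\<lambda>n. Bn n o\<^sub>L An n) \<longlonglongrightarrow> (B o\<^sub>L A) \<and>
       (\<lambda>n. orth_proj sK ipK (orth_compl ipK (Sn n))) \<longlonglongrightarrow> orth_proj sK ipK (orth_compl ipK S)) \<and>
     (Bn \<longlonglongrightarrow> B \<longleftrightarrow>
       (\<lambda>n. An n o\<^sub>L Bn n) \<longlonglongrightarrow> (A o\<^sub>L B) \<and>
       (\<lambda>n. orth_proj sH ipH (Tn n)) \<longlonglongrightarrow> orth_proj sH ipH T) \<and>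
     (Bn \<longlonglongrightarrow> B \<longleftrightarrow>
       (\<lambda>n. orth_proj sK ipK (orth_compl ipK (Sn n))) \<longlonglongrightarrow> orth_proj sK ipK (orth_compl ipK S) \<and>
       (\<lambda>n. orth_proj sH ipH (Tn n)) \<longlonglongrightarrow> orth_proj sH ipH T)"
proof -
  interpret H: hilbert_space sH ipH by fact
  interpret K: hilbert_space sK ipK by fact
  let ?P = "orth_proj sH ipH T" and ?Pn = "\<lambda>n. orth_proj sH ipH (Tn n)"
  let ?Q = "orth_proj sK ipK (orth_compl ipK S)"
  let ?Qn = "\<lambda>n. orth_proj sK ipK (orth_compl ipK (Sn n))"
  have oB: "is_outer_inverse sH sK A T S B"
    unfolding B by (rule is_outer_inverse_outer_inverse) fact
  have oBn: "is_outer_inverse sH sK (An n) (Tn n) (Sn n) (Bn n)" for n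
    unfolding Bn by (rule is_outer_inverse_outer_inverse) fact
  have P: "?Pn \<longlonglongrightarrow> ?P" if "(\<lambda>n. Bn n o\<^sub>L An n) \<longlonglongrightarrow> (B o\<^sub>L A)"
    by (intro H.orth_proj_tendsto[OF _ _ outer_inverse_idem_left[OF oB] outer_inverse_range_left[OF oB]
      outer_inverse_idem_left[OF oBn] outer_inverse_range_left[OF oBn] that] assms)
  have Q: "?Qn \<longlonglongrightarrow> ?Q" if "(\<lambda>n. An n o\<^sub>L Bn n) \<longlonglongrightarrow> (A o\<^sub>L B)"
  proof -
    have "(\<lambda>n. id_blinfun - (An n o\<^sub>L Bn n)) \<longlonglongrightarrow> (id_blinfun - (A o\<^sub>L B))"
      by (intro tendsto_intros that)
    then have "(\<lambda>n. orth_proj sK ipK (Sn n)) \<longlonglongrightarrow> orth_proj sK ipK S"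
      by (intro K.orth_proj_tendsto[OF _ _ outer_inverse_idem_right[OF oB]
        outer_inverse_range_right[OF oB] outer_inverse_idem_right[OF oBn]
        outer_inverse_range_right[OF oBn]] assms)
    then show ?thesis
      \<comment> \<open>The convergence just obtained is for projections onto \<open>Sn n\<close>;
        subtracting from the identity turns it into the one for the complements.\<close>
      using assms by (simp add: K.orth_proj_orth_compl tendsto_diff)
  qed
  have i_ii: "(\<lambda>n. Bn n o\<^sub>L An n) \<longlonglongrightarrow> (B o\<^sub>L A)" "(\<lambda>n. An n o\<^sub>L Bn n) \<longlonglongrightarrow> (A o\<^sub>L B)" if "Bn \<longlonglongrightarrow> B"
    by (intro tendsto_blinfun_compose that assms)+
  have v_i: "Bn \<longlonglongrightarrow> B" if Qlim: "?Qn \<longlonglongrightarrow> ?Q" and Plim: "?Pn \<longlonglongrightarrow> ?P"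
  proof -
    define X where "X n = (?Qn n - ?Q) o\<^sub>L (id_blinfun - (A o\<^sub>L B))" for n
    define Y where "Y n = (?Pn n - ?P) o\<^sub>L B" for n
    define Z where "Z n = (An n - A) o\<^sub>L B" for n
    have "X \<longlonglongrightarrow> (0 o\<^sub>L (id_blinfun - (A o\<^sub>L B)))"
      unfolding X_def by (intro tendsto_blinfun_compose LIM_zero Qlim tendsto_const)
    then have X: "X \<longlonglongrightarrow> 0"
      by (simp add: bounded_bilinear.zero_left[OF bounded_bilinear_blinfun_compose])
    have "Y \<longlonglongrightarrow> (0 o\<^sub>L B)"
      unfolding Y_def by (intro tendsto_blinfun_compose LIM_zero Plim tendsto_const)
    then have Y: "Y \<longlonglongrightarrow> 0"
      by (simp add: bounded_bilinear.zero_left[OF bounded_bilinear_blinfun_compose])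
    have "Z \<longlonglongrightarrow> (0 o\<^sub>L B)"
      unfolding Z_def by (intro tendsto_blinfun_compose LIM_zero assms tendsto_const)
    then have Z: "Z \<longlonglongrightarrow> 0"
      by (simp add: bounded_bilinear.zero_left[OF bounded_bilinear_blinfun_compose])
    have diff: "Bn n - B = (Bn n o\<^sub>L X n) + Y n - (Bn n o\<^sub>L (An n o\<^sub>L Y n)) - (Bn n o\<^sub>L Z n)" for n
      unfolding X_def Y_def Z_def
      \<comment> \<open>Here \<open>id_blinfun - ?Q\<close> simplifies to the projection onto
        \<open>S\<close>, because \<open>?Q\<close> is itself the identity minus that projection;
        likewise for each \<open>n\<close>.\<close>
      by (rule outer_inverse_diff[OF assms(1,2) oB oBn])
        (use assms in \<open>simp_all add: H.is_orth_proj_orth_proj K.is_orth_proj_orth_proj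
          K.orth_proj_orth_compl\<close>)
    show ?thesis
    proof (rule tendsto_of_norm_diff_le_self)
      \<comment> \<open>This is the coefficient of \<open>norm (Bn n)\<close> in the estimate of
        \<open>diff\<close>; its middle term vanishes in the limit because
        \<open>norm (An n)\<close> converges. The term \<open>Y n\<close> without a factor
        \<open>Bn n\<close> becomes the additive error.\<close>
      have "(\<lambda>n. norm (X n) + norm (An n) * norm (Y n) + norm (Z n))
          \<longlonglongrightarrow> norm (0 :: 'k \<Rightarrow>\<^sub>L 'k) + norm A * norm (0 :: 'k \<Rightarrow>\<^sub>L 'h) + norm (0 :: 'k \<Rightarrow>\<^sub>L 'k)"
        by (intro tendsto_intros X Y Z assms)
      then show "(\<lambda>n. norm (X n) + norm (An n) * norm (Y n) + norm (Z n)) \<longlonglongrightarrow> 0"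
        by simp
      show "(\<lambda>n. norm (Y n)) \<longlonglongrightarrow> 0"
        using Y by (rule tendsto_norm_zero)
      fix n
      have "norm (Bn n - B) \<le> norm (Bn n o\<^sub>L X n) + norm (Y n)
          + norm (Bn n o\<^sub>L (An n o\<^sub>L Y n)) + norm (Bn n o\<^sub>L Z n)"
        unfolding diff by (intro norm_triangle_le_diff norm_triangle_le add_mono order_refl)
      also have "\<dots> \<le> norm (Bn n) * norm (X n) + norm (Y n)
          + norm (Bn n) * (norm (An n) * norm (Y n)) + norm (Bn n) * norm (Z n)"
        by (intro add_mono order_refl norm_blinfun_compose
          order_trans[OF norm_blinfun_compose mult_left_mono[OF norm_blinfun_compose]] norm_ge_zero)
      finally show "norm (Bn n - B)
          \<le> norm (Bn n) * (norm (X n) + norm (An n) * norm (Y n) + norm (Z n)) + norm (Y n)"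
        by (simp add: algebra_simps)
    qed
  qed
  show ?thesis
    \<comment> \<open>From (i), \<open>i_ii\<close> gives both product limits, and \<open>P\<close>
      and \<open>Q\<close> then give both projection limits. Conversely, each of (ii) to (iv) yields
      (v) by \<open>P\<close>, \<open>Q\<close> or both, and \<open>v_i\<close> leads back to
      (i).\<close>
    using P Q i_ii v_i by blast
qed

end
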